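(* There is a hereditary graph property $\mathcal{P}$ such that for every $M>0$, there is no tester for $\mathcal{P}$ in the VDF model even under the promise that the input graph has at least $M$ vertices. That is, for every $M>0$ there do not exist a function $q:(0,1)\to\mathbb{N}$ and an algorithm in the VDF model that, for every $\varepsilon\in(0,1)$, always makes at most $q(\varepsilon)$ vertex samples and edge queries and, for every vertex-weighted graph $(G,\mathcal{D})$ with $|V(G)|\ge M$, accepts with probability at least $2/3$ if $G\in\mathcal{P}$ and rejects with probability at least $2/3$ if $(G,\mathcal{D})$ is $\varepsilon$-far from $\mathcal{P}$.
   Context: All graphs are finite, simple, undirected, with nonempty vertex set. A graph property is a family of graphs closed under isomorphism; it is hereditary if it is closed under removal of vertices. A vertex-weighted graph is a pair $(G,\mathcal{D})$ with $G$ a graph and $\mathcal{D}$ a probability distribution on $V(G)$ (weight $0$ is allowed). For graphs $G_1,G_2$ on the same vertex set $V$ and a distribution $\mathcal{D}$ on $V$, their distance with respect to $\mathcal{D}$ is $\sum_{\{x,y\}\in E(G_1)\triangle E(G_2)}\mathcal{D}(x)\mathcal{D}(y)$. $(G,\mathcal{D})$ is $\varepsilon$-far from $\mathcal{P}$ if for every $G'\in\mathcal{P}$ with $V(G')=V(G)$ the distance between $G$ and $G'$ with respect to $\mathcal{D}$ is at least $\varepsilon$ (vacuously true if no such $G'$ exists). VDF model. The input is $(G,\mathcal{D})$, with $\mathcal{D}$ unknown to the algorithm, and a parameter $\varepsilon\in(0,1)$. A (randomized, possibly adaptive) algorithm accesses the input only by drawing independent random vertices distributed according to $\mathcal{D}$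 (it can tell whether two samples are the same vertex, but vertex names carry no other information) and by edge queries "is $\{u,v\}$ an edge of $G$?" for sampled vertices $u,v$; it is not given $|V(G)|$. There is no restriction on computation. *)

theory Defs
  imports "HOL-Probability.Probability"
begin

section \<open>Graphs and graph properties\<close>

type_synonym 'v graph = "'v set \<times> 'v set set"

abbreviation verts :: "'v graph \<Rightarrow> 'v set" where "verts G \<equiv> fst G"
abbreviation edges :: "'v graph \<Rightarrow> 'v set set" where "edges G \<equiv> snd G"

definition is_graph :: "'v graph \<Rightarrow> bool" where
  "is_graph G \<longleftrightarrow> finite (verts G) \<and> verts G \<noteq> {} \<and>
     (\<forall>e\<in>edges G. e \<subseteq> verts G \<and> card e = 2)"

definition graph_iso :: "'v graph \<Rightarrow> 'w graph \<Rightarrow> bool" where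
  "graph_iso G H \<longleftrightarrow>
     (\<exists>f. bij_betw f (verts G) (verts H) \<and> edges H = (\<lambda>e. f ` e) ` edges G)"

definition remove_verts :: "'v graph \<Rightarrow> 'v set \<Rightarrow> 'v graph" where
  "remove_verts G S = (verts G - S, {e \<in> edges G. e \<inter> S = {}})"

definition graph_property :: "'v graph set \<Rightarrow> bool" where
  "graph_property P \<longleftrightarrow> (\<forall>G\<in>P. is_graph G) \<and>
     (\<forall>G\<in>P. \<forall>H. is_graph H \<longrightarrow> graph_iso G H \<longrightarrow> H \<in> P)"

text \<open>Graphs have a nonempty vertex set, so at least one vertex has to survive the removal.\<close>

definition hereditary :: "'v graph set \<Rightarrow> bool" where
  "hereditary P \<longleftrightarrow>
     (\<forall>G\<in>P. \<forall>S. S \<subseteq> verts G \<longrightarrow> S \<noteq> verts G \<longrightarrow> remove_verts G S \<in> P)"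

section \<open>Vertex-weighted graphs and distance\<close>

definition weighted_graph :: "'v graph \<Rightarrow> 'v pmf \<Rightarrow> bool" where
  "weighted_graph G D \<longleftrightarrow> is_graph G \<and> set_pmf D \<subseteq> verts G"

text \<open>An edge is a two-element set \<open>{x, y}\<close>, so the inner product is \<open>D(x) D(y)\<close>.\<close>

definition graph_dist :: "'v pmf \<Rightarrow> 'v graph \<Rightarrow> 'v graph \<Rightarrow> real" where
  "graph_dist D G H =
     (\<Sum>e\<in>(edges G - edges H) \<union> (edges H - edges G). \<Prod>x\<in>e. pmf D x)"

definition far_from :: "real \<Rightarrow> 'v graph \<Rightarrow> 'v pmf \<Rightarrow> 'v graph set \<Rightarrow> bool" where
  "far_from \<epsilon> G D P \<longleftrightarrow> (\<forall>H\<in>P. verts H = verts G \<longrightarrow> graph_dist D G H \<ge> \<epsilon>)"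

section \<open>The VDF model\<close>

text \<open>
  An algorithm is a decision tree. It halts (\<open>True\<close> means accept), makes an internal random
  choice from an arbitrary discrete distribution, draws a vertex, or queries a pair of vertices
  drawn so far. The \<open>i\<close>-th drawn vertex (counting from 0, with repetitions) is referred to by its
  index \<open>i\<close>. Discrete internal randomness loses nothing: up to its behaviour on actual
  inputs, a deterministic algorithm with bounded cost is one of finitely many.
\<close>

datatype vdf_alg =
    Halt bool
  | Toss "nat pmf" "nat \<Rightarrow> vdf_alg"
  | Sample "nat \<Rightarrow> vdf_alg"
  | Query nat nat "bool \<Rightarrow> vdf_alg"

text \<open>
  Joint distribution of the verdict and the number of vertex samples and edge queries made, where
  \<open>xs\<close> lists the vertices drawn so far. All the algorithm learns about a new sample is the least
  index of a sample equal to it, which is its own index iff the vertex has not been drawn before.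
  A query with an index that has not been drawn yet is answered negatively (and counted).
\<close>

primrec run :: "vdf_alg \<Rightarrow> 'v graph \<Rightarrow> 'v pmf \<Rightarrow> 'v list \<Rightarrow> (bool \<times> nat) pmf" where
  "run (Halt b) G D xs = return_pmf (b, 0)"
| "run (Toss p k) G D xs = bind_pmf p (\<lambda>n. run (k n) G D xs)"
| "run (Sample k) G D xs = bind_pmf D (\<lambda>x.
     map_pmf (apsnd Suc) (run (k (LEAST i. (xs @ [x]) ! i = x)) G D (xs @ [x])))"
| "run (Query i j k) G D xs = map_pmf (apsnd Suc)
     (run (k (i < length xs \<and> j < length xs \<and> {xs ! i, xs ! j} \<in> edges G)) G D xs)"

definition prob_verdict :: "vdf_alg \<Rightarrow> 'v graph \<Rightarrow> 'v pmf \<Rightarrow> bool \<Rightarrow> real" where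
  "prob_verdict a G D b = pmf (map_pmf fst (run a G D [])) b"

text \<open>
  Algorithms do not see vertex names and properties are isomorphism-closed, so graphs on finite
  sets of natural numbers represent all finite graphs. The cost bound is required on every outcome
  of positive probability, for every input.
\<close>

definition cost_at_most :: "vdf_alg \<Rightarrow> nat \<Rightarrow> bool" where
  "cost_at_most a n \<longleftrightarrow> (\<forall>(G :: nat graph) D. weighted_graph G D \<longrightarrow>
     (\<forall>(b, c)\<in>set_pmf (run a G D []). c \<le> n))"

text \<open>The algorithm \<open>A\<close> receives the parameter \<open>\<epsilon>\<close>; the promise is \<open>|V(G)| \<ge> M\<close>.\<close>

definition vdf_tester ::
    "nat graph set \<Rightarrow> nat \<Rightarrow> (real \<Rightarrow> nat) \<Rightarrow> (real \<Rightarrow> vdf_alg) \<Rightarrow> bool" where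
  "vdf_tester P M q A \<longleftrightarrow> (\<forall>\<epsilon>. 0 < \<epsilon> \<longrightarrow> \<epsilon> < 1 \<longrightarrow>
     cost_at_most (A \<epsilon>) (q \<epsilon>) \<and>
     (\<forall>G D. weighted_graph G D \<longrightarrow> card (verts G) \<ge> M \<longrightarrow>
        (G \<in> P \<longrightarrow> prob_verdict (A \<epsilon>) G D True \<ge> 2/3) \<and>
        (far_from \<epsilon> G D P \<longrightarrow> prob_verdict (A \<epsilon>) G D False \<ge> 2/3)))"

end

theory Submission
  imports Defs
begin

text \<open>
  Take the graphs in which no proper nonempty set of vertices induces a subgraph of minimum degree
  at least two. Every cycle has this property, but no graph that contains a cycle together with a
  further vertex does. Hence the \<open>n\<close>-cycle with the uniform distribution has the property, whereas
  after adding an isolated vertex of weight \<open>0\<close> it is \<open>1/n\<^sup>2\<close>-far from it: at least one edge of the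
  cycle must be deleted. A vertex of weight \<open>0\<close> is never drawn, so an algorithm behaves identically
  on the two inputs.
\<close>

text \<open>Two distinct witnesses in place of a degree count make monotonicity in \<open>E\<close>
  immediate. The condition holds vacuously for the empty set, which \<open>core_free\<close>
  therefore excludes.\<close>

definition min_degree_two :: "'v set set \<Rightarrow> 'v set \<Rightarrow> bool" where
  "min_degree_two E S \<longleftrightarrow>
     (\<forall>v\<in>S. \<exists>e1\<in>E. \<exists>e2\<in>E. e1 \<noteq> e2 \<and> v \<in> e1 \<and> v \<in> e2 \<and> e1 \<subseteq> S \<and> e2 \<subseteq> S)"

definition core_free :: "'v graph set" where
  "core_free = {G. is_graph G \<and>
     (\<forall>S. S \<subset> verts G \<longrightarrow> S \<noteq> {} \<longrightarrow> \<not> min_degree_two (edges G) S)}"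

lemma min_degree_two_mono:
  "min_degree_two E S \<Longrightarrow> E \<subseteq> F \<Longrightarrow> min_degree_two F S"
  unfolding min_degree_two_def by (meson subsetD)

text \<open>Injectivity on \<open>V\<close> lets membership and inclusion be pulled back along
  \<open>f\<close>. This direction is what carries a forbidden set of an isomorphic copy back to the
  original graph.\<close>

lemma min_degree_two_image:
  assumes "inj_on f V" and "\<And>e. e \<in> E \<Longrightarrow> e \<subseteq> V" and "S \<subseteq> V"
    and "min_degree_two ((`) f ` E) (f ` S)"
  shows "min_degree_two E S"
  unfolding min_degree_two_def
proof
  fix v assume "v \<in> S"
  then obtain d1 d2 where d: "d1 \<in> (`) f ` E" "d2 \<in> (`) f ` E" "d1 \<noteq> d2"
      "f v \<in> d1" "f v \<in> d2" "d1 \<subseteq> f ` S" "d2 \<subseteq> f ` S"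
    using assms(4) unfolding min_degree_two_def by (meson imageI)
  obtain e1 e2 where e: "e1 \<in> E" "d1 = f ` e1" "e2 \<in> E" "d2 = f ` e2"
    using d(1,2) by (elim imageE)
  have vV: "v \<in> V" using \<open>v \<in> S\<close> assms(3) by (rule subsetD[rotated])
  have pre: "v \<in> e \<and> e \<subseteq> S" if "e \<in> E" "f v \<in> f ` e" "f ` e \<subseteq> f ` S" for e
    using that(2,3) inj_on_image_mem_iff[OF assms(1) vV assms(2)[OF that(1)]]
      inj_on_image_subset_iff[OF assms(1) assms(2)[OF that(1)] assms(3)]
    by simp
  have "e1 \<noteq> e2" using d(3) e(2,4) by metis
  then show "\<exists>e1\<in>E. \<exists>e2\<in>E. e1 \<noteq> e2 \<and> v \<in> e1 \<and> v \<in> e2 \<and> e1 \<subseteq> S \<and> e2 \<subseteq> S"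
    using pre[OF e(1)] pre[OF e(3)] d(4-7) e by metis
qed

lemma graph_property_core_free: "graph_property core_free"
  unfolding graph_property_def
proof (intro conjI ballI allI impI)
  fix G :: "'a graph" assume "G \<in> core_free"
  then show "is_graph G" by (simp add: core_free_def)
next
  fix G H :: "'a graph"
  assume G: "G \<in> core_free" and H: "is_graph H" and "graph_iso G H"
  then obtain f where f: "bij_betw f (verts G) (verts H)" and E: "edges H = (`) f ` edges G"
    unfolding graph_iso_def by blast
  have "\<not> min_degree_two (edges H) T" if T: "T \<subset> verts H" "T \<noteq> {}" for T
  proof
    assume "min_degree_two (edges H) T"
    obtain S where S: "S \<subseteq> verts G" "T = f ` S"
      using T f by (metis bij_betw_def psubset_imp_subset subset_image_iff)
    have "min_degree_two (edges G) S"
      using min_degree_two_image[of f "verts G" "edges G" S] f G S E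
        \<open>min_degree_two (edges H) T\<close>
      by (auto simp: bij_betw_def core_free_def is_graph_def)
    moreover have "S \<subset> verts G" "S \<noteq> {}"
      using S T f by (auto simp: bij_betw_def)
    ultimately show False
      using G by (auto simp: core_free_def)
  qed
  with H show "H \<in> core_free" by (simp add: core_free_def)
qed

text \<open>Removing vertices creates no edges, and a proper subset of the remaining vertices is
  also a proper subset of the original ones, so a forbidden set would already be present before the
  removal.\<close>

lemma hereditary_core_free: "hereditary core_free"
  unfolding hereditary_def
proof (intro ballI allI impI)
  fix G :: "'a graph" and S
  assume G: "G \<in> core_free" and S: "S \<subseteq> verts G" "S \<noteq> verts G"
  have "is_graph (remove_verts G S)"
    using G S by (auto simp: core_free_def is_graph_def remove_verts_def)
  moreover have "\<not> min_degree_two (edges (remove_verts G S)) T"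
    if T: "T \<subset> verts (remove_verts G S)" "T \<noteq> {}" for T
  proof
    assume "min_degree_two (edges (remove_verts G S)) T"
    then have "min_degree_two (edges G) T"
      by (rule min_degree_two_mono) (auto simp: remove_verts_def)
    moreover have "T \<subset> verts G" using T by (auto simp: remove_verts_def)
    ultimately show False using G T by (auto simp: core_free_def)
  qed
  ultimately show "remove_verts G S \<in> core_free" by (simp add: core_free_def)
qed

definition cycle_edges :: "nat \<Rightarrow> nat set set" where
  "cycle_edges n = (\<lambda>i. {i, Suc i mod n}) ` {..<n}"

lemma cycle_edge:
  assumes "e \<in> cycle_edges n" and "n \<ge> 2"
  shows "e \<subseteq> {..<n}" and "card e = 2"
proof -
  obtain i where i: "i < n" "e = {i, Suc i mod n}"
    using assms(1) by (auto simp: cycle_edges_def)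
  moreover have "i \<noteq> Suc i mod n" using i(1) assms(2) by (auto simp: mod_Suc)
  ultimately show "e \<subseteq> {..<n}" "card e = 2" by auto
qed

lemma min_degree_two_cycle:
  assumes "n \<ge> 3"
  shows "min_degree_two (cycle_edges n) {..<n}"
  unfolding min_degree_two_def
proof
  fix v assume "v \<in> {..<n}"
  then have v: "v < n" by simp
  \<comment> \<open>The predecessor of \<open>v\<close> on the cycle. It differs from the successor
    because \<open>n\<close> is at least 3; for \<open>n = 2\<close> the two edges at
    \<open>v\<close> would coincide.\<close>
  define p where "p = (if v = 0 then n - 1 else v - 1)"
  have p: "p < n" "Suc p mod n = v" "p \<noteq> v" "p \<noteq> Suc v mod n"
    using v assms by (auto simp: p_def mod_Suc)
  show "\<exists>e1\<in>cycle_edges n. \<exists>e2\<in>cycle_edges n.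
      e1 \<noteq> e2 \<and> v \<in> e1 \<and> v \<in> e2 \<and> e1 \<subseteq> {..<n} \<and> e2 \<subseteq> {..<n}"
  proof (rule bexI[of _ "{v, Suc v mod n}"], rule bexI[of _ "{p, v}"], intro conjI)
    show "{v, Suc v mod n} \<in> cycle_edges n" "{p, v} \<in> cycle_edges n"
      using v p(1,2) by (auto simp: cycle_edges_def)
    show "{v, Suc v mod n} \<noteq> {p, v}" using p(3,4) by auto
    show "{v, Suc v mod n} \<subseteq> {..<n}" "{p, v} \<subseteq> {..<n}" using v p(1) by auto
  qed auto
qed

text \<open>A vertex of the cycle has only two edges, so both must lie inside \<open>S\<close>. Thus
  \<open>S\<close> is closed under successors and runs around the whole cycle.\<close>

lemma min_degree_two_cycle_subset:
  assumes min: "min_degree_two (cycle_edges n) S" and "S \<subseteq> {..<n}" and "S \<noteq> {}"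
  shows "S = {..<n}"
proof -
  have closed: "Suc v mod n \<in> S" if "v \<in> S" for v
  proof -
    obtain e1 e2 where e: "e1 \<in> cycle_edges n" "e2 \<in> cycle_edges n" "e1 \<noteq> e2"
        "v \<in> e1" "v \<in> e2" "e1 \<subseteq> S" "e2 \<subseteq> S"
      using bspec[OF min[unfolded min_degree_two_def] \<open>v \<in> S\<close>] by (elim bexE conjE)
    obtain i j where "i < n" "j < n" "e1 = {i, Suc i mod n}" "e2 = {j, Suc j mod n}"
      using e(1,2) unfolding cycle_edges_def by auto
    with e have ij: "i < n" "j < n" "{i, Suc i mod n} \<noteq> {j, Suc j mod n}"
        "v \<in> {i, Suc i mod n}" "v \<in> {j, Suc j mod n}"
        "{i, Suc i mod n} \<subseteq> S" "{j, Suc j mod n} \<subseteq> S"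
      by simp_all
    \<comment> \<open>The successor map is injective, so \<open>v\<close> cannot be the far end of
      two distinct edges. Hence \<open>v\<close> is \<open>i\<close> or \<open>j\<close>, and the
      far end of that edge is the successor of \<open>v\<close>.\<close>
    have "i = j" if "Suc i mod n = Suc j mod n"
      using that ij(1,2) by (auto simp: mod_Suc split: if_splits)
    with ij show ?thesis by auto
  qed
  obtain v where v: "v \<in> S" using assms(3) by blast
  have shift: "(v + k) mod n \<in> S" for k
  proof (induction k)
    case 0
    then show ?case using v assms(2) by auto
  next
    case (Suc k)
    then show ?case using closed[OF Suc] by (simp add: mod_Suc_eq)
  qed
  \<comment> \<open>Going \<open>n - v\<close> steps from \<open>v\<close> reaches 0, and
    \<open>w\<close> more steps reach \<open>w\<close>; \<open>v < n\<close> keeps the subtraction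
    exact.\<close>
  have "w \<in> S" if "w < n" for w
    using shift[of "n - v + w"] that v assms(2) by auto
  with assms(2) show ?thesis by auto
qed

lemma cycle_core_free:
  assumes "n \<ge> 2"
  shows "({..<n}, cycle_edges n) \<in> core_free"
proof -
  have "is_graph ({..<n}, cycle_edges n)"
    using assms cycle_edge by (auto simp: is_graph_def lessThan_empty_iff)
  then show ?thesis
    using min_degree_two_cycle_subset[of n] by (auto simp: core_free_def)
qed

text \<open>A run consults the graph only in edge queries, and samples come from \<open>D\<close>
  alone. A vertex without edges and outside the support of \<open>D\<close> is thus
  invisible.\<close>

lemma run_cong_edges:
  "edges G = edges H \<Longrightarrow> run a G D xs = run a H D xs"
  by (induction a arbitrary: xs) simp_all

lemma prob_verdict_sum: "prob_verdict a G D True + prob_verdict a G D False = 1"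
proof -
  have "(\<Sum>b\<in>UNIV. pmf (map_pmf fst (run a G D [])) b) = 1"
    by (rule sum_pmf_eq_1) auto
  then show ?thesis by (simp add: prob_verdict_def UNIV_bool)
qed

text \<open>The extra vertex \<open>n\<close> makes \<open>{..<n}\<close> a proper subset, so a
  graph with the property misses some cycle edge. That edge alone contributes the bound, and all
  other terms are nonnegative.\<close>

lemma far_from_core_free:
  assumes "n \<ge> 3"
  shows "far_from (1 / real n ^ 2) ({..n}, cycle_edges n) (pmf_of_set {..<n}) core_free"
  unfolding far_from_def
proof (intro ballI impI)
  let ?D = "pmf_of_set {..<n}"
  let ?G = "({..n}, cycle_edges n)"
  fix H assume H: "H \<in> core_free" and "verts H = verts ?G"
  then have V: "verts H = {..n}" by simp
  have "\<not> cycle_edges n \<subseteq> edges H"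
  proof
    assume "cycle_edges n \<subseteq> edges H"
    then have "min_degree_two (edges H) {..<n}"
      using min_degree_two_cycle[OF assms] min_degree_two_mono by blast
    moreover have "{..<n} \<subset> verts H" "{..<n} \<noteq> {}" using V assms by (auto simp: lessThan_empty_iff)
    ultimately show False using H by (auto simp: core_free_def)
  qed
  then obtain e where e: "e \<in> cycle_edges n" "e \<notin> edges H" by blast
  have "pmf ?D x = 1 / real n" if "x \<in> e" for x
    using that cycle_edge(1)[OF e(1)] assms by (auto simp: lessThan_empty_iff)
  then have "(\<Prod>x\<in>e. pmf ?D x) = 1 / real n ^ 2"
    using cycle_edge(2)[OF e(1)] assms by (simp add: power_one_over)
  \<comment> \<open>Finiteness matters here: a sum over an infinite set is 0 by default.\<close>
  moreover have "edges H \<subseteq> Pow {..n}"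
    using H V by (auto simp: core_free_def is_graph_def)
  then have "finite (edges H)" by (rule finite_subset) simp
  then have "(\<Prod>x\<in>e. pmf ?D x) \<le> graph_dist ?D ?G H"
    unfolding graph_dist_def using e
    by (intro member_le_sum) (auto intro: prod_nonneg simp: cycle_edges_def)
  ultimately show "1 / real n ^ 2 \<le> graph_dist ?D ?G H" by simp
qed

theorem proposition5p2:
  "\<exists>P :: nat graph set. graph_property P \<and> hereditary P \<and>
     (\<forall>M>0. \<not> (\<exists>q A. vdf_tester P M q A))"
proof (intro exI conjI allI impI notI)
  show "graph_property core_free" by (rule graph_property_core_free)
  show "hereditary core_free" by (rule hereditary_core_free)
  fix M :: nat
  assume "\<exists>q A. vdf_tester core_free M q A"
  then obtain q A where tester: "vdf_tester core_free M q A" by blast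
  \<comment> \<open>The bound \<open>M\<close> meets the promise and 3 gives a genuine cycle. As
    \<open>M\<close> is fixed, the parameter \<open>\<epsilon>\<close> may depend on it, and
    refuting the tester at this one value suffices.\<close>
  define n where "n = max M 3"
  have n: "n \<ge> 3" "n \<ge> M" by (auto simp: n_def)
  define \<epsilon> where "\<epsilon> = 1 / real n ^ 2"
  have "1 < real n ^ 2" using n by (intro one_less_power) auto
  then have \<epsilon>: "0 < \<epsilon>" "\<epsilon> < 1" using n(1) by (simp_all add: \<epsilon>_def)
  let ?D = "pmf_of_set {..<n}"
  let ?G = "({..<n}, cycle_edges n)" and ?H = "({..n}, cycle_edges n)"
  have D: "set_pmf ?D = {..<n}" using n by (intro set_pmf_of_set) (auto simp: lessThan_empty_iff)
  have G: "?G \<in> core_free" using n by (intro cycle_core_free) simp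
  have "weighted_graph ?G ?D" using G D by (auto simp: weighted_graph_def core_free_def)
  moreover have "weighted_graph ?H ?D"
    using \<open>weighted_graph ?G ?D\<close> by (fastforce simp: weighted_graph_def is_graph_def)
  moreover have "far_from \<epsilon> ?H ?D core_free"
    unfolding \<epsilon>_def using n(1) by (rule far_from_core_free)
  moreover have "card (verts ?G) \<ge> M" "card (verts ?H) \<ge> M" using n by auto
  ultimately have "prob_verdict (A \<epsilon>) ?G ?D True \<ge> 2/3" "prob_verdict (A \<epsilon>) ?H ?D False \<ge> 2/3"
    using tester \<epsilon> G unfolding vdf_tester_def by blast+
  moreover have "prob_verdict (A \<epsilon>) ?H ?D False = prob_verdict (A \<epsilon>) ?G ?D False"
    unfolding prob_verdict_def by (subst run_cong_edges[of ?H ?G]) auto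
  \<comment> \<open>Both verdicts would have probability at least 2/3 on the same input
    \<open>?G\<close>, exceeding the total of 1.\<close>
  ultimately show False using prob_verdict_sum[of "A \<epsilon>" ?G ?D] by linarith
qed

end
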